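(* Let $\mathbf{J}$ be a chain and $n\in\mathbb{Z}^+$. A map $f$ on $J\times\mathbb{Z}$ belongs to $F_n(\mathbf{J}\overrightarrow{\times}\mathbb{Z})$ if and only if there exist an order-preserving bijection $\widetilde f:J\to J$ and maps $\overline f_j\in F_n(\mathbb{Z})$, one for each $j\in J$, such that $f(j,r)=(\widetilde f(j),\overline f_j(r))$ for all $(j,r)\in J\times\mathbb{Z}$.
   Context: For a chain $\Omega$ and order-preserving $f:\Omega\to\Omega$, the residual is $f^r(b)=\max\{a:f(a)\le b\}$ and the dual residual is $f^\ell(a)=\min\{b:a\le f(b)\}$, when they exist. $F(\Omega)$ is the set of maps on $\Omega$ having residuals and dual residuals of all orders (all iterates $f^{\ell\ell\cdots}$, $f^{rr\cdots}$ exist), and $F_n(\Omega)$ is the set of $f\in F(\Omega)$ with $f^{\ell^n}=f^{r^n}$. $\mathbf{J}\overrightarrow{\times}\mathbb{Z}$ is the lexicographic product: $(i,a)\le(j,b)$ iff $i<j$, or $i=j$ and $a\le b$. *)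

theory Defs
  imports Main "HOL-Library.Product_Lexorder"
begin

text \<open>
  A chain is a type of class \<^class>\<open>linorder\<close>; the order on a product type is the
  lexicographic one of \<^theory>\<open>HOL-Library.Product_Lexorder\<close>.
  The residual and the dual residual are total functions whose values are only meaningful
  when the maximum (minimum) in question exists, which is expressed separately by
  \<open>has_residual\<close> and \<open>has_dual_residual\<close>.
\<close>

definition has_residual :: "('a::linorder \<Rightarrow> 'a) \<Rightarrow> bool" where
  "has_residual f \<longleftrightarrow> (\<forall>b. \<exists>m. f m \<le> b \<and> (\<forall>a. f a \<le> b \<longrightarrow> a \<le> m))"

definition residual :: "('a::linorder \<Rightarrow> 'a) \<Rightarrow> ('a \<Rightarrow> 'a)" where
  "residual f = (\<lambda>b. GREATEST a. f a \<le> b)"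

definition has_dual_residual :: "('a::linorder \<Rightarrow> 'a) \<Rightarrow> bool" where
  "has_dual_residual f \<longleftrightarrow> (\<forall>a. \<exists>m. a \<le> f m \<and> (\<forall>b. a \<le> f b \<longrightarrow> m \<le> b))"

definition dual_residual :: "('a::linorder \<Rightarrow> 'a) \<Rightarrow> ('a \<Rightarrow> 'a)" where
  "dual_residual f = (\<lambda>a. LEAST b. a \<le> f b)"

text \<open>\<open>residuated_maps\<close> is \<open>F(\<Omega>)\<close> and \<open>periodic_maps n\<close> is \<open>F\<^sub>n(\<Omega>)\<close>. Monotonicity is only
  required of \<open>f\<close>, because residuals and dual residuals that exist inherit it.\<close>

definition residuated_maps :: "('a::linorder \<Rightarrow> 'a) set" where
  "residuated_maps = {f. mono f \<and>
     (\<forall>k. has_residual ((residual ^^ k) f)) \<and>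
     (\<forall>k. has_dual_residual ((dual_residual ^^ k) f))}"

definition periodic_maps :: "nat \<Rightarrow> ('a::linorder \<Rightarrow> 'a) set" where
  "periodic_maps n =
     {f \<in> residuated_maps. (dual_residual ^^ n) f = (residual ^^ n) f}"

end

theory Submission
  imports Defs
begin

text \<open>
  On a chain with a successor bijection \<open>s\<close>, complementing both sides of the adjunction
  \<open>f a \<le> b \<longleftrightarrow> a \<le> g b\<close> shows that \<open>g\<close> is left adjoint to \<open>s\<inverse> \<circ> f \<circ> s\<close>. Hence one
  adjoint yields residuals of all orders, \<open>f\<^sup>r\<^sup>r = s\<inverse> \<circ> f \<circ> s\<close>, and \<open>f\<close> lies in \<open>F\<^sub>n\<close> iff
  it has a right adjoint and commutes with \<open>s\<^sup>n\<close>. In \<open>J \<times> \<int>\<close>, commutation with the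
  shift by \<open>n\<close> on the second coordinate forces \<open>f\<close> to respect the blocks \<open>{j} \<times> \<int>\<close>, and
  the existence of an adjoint makes the induced map on \<open>J\<close> surjective.
\<close>

section \<open>Residuals as adjoints on an arbitrary chain\<close>

definition adjoint :: "('a::linorder \<Rightarrow> 'a) \<Rightarrow> ('a \<Rightarrow> 'a) \<Rightarrow> bool" where
  "adjoint f g \<longleftrightarrow> (\<forall>a b. f a \<le> b \<longleftrightarrow> a \<le> g b)"

text \<open>Monotonicity is what makes the solution set of \<open>f a \<le> b\<close> downward
  closed, so that its maximum describes it completely.\<close>

lemma adjoint_residual:
  assumes "mono f" "has_residual f"
  shows "adjoint f (residual f)"
proof -
  have "f a \<le> b \<longleftrightarrow> a \<le> residual f b" for a b
  proof -
    obtain m where m: "f m \<le> b" "\<And>a. f a \<le> b \<Longrightarrow> a \<le> m"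
      using assms(2) unfolding has_residual_def by blast
    have "residual f b = m"
      unfolding residual_def by (rule Greatest_equality) (use m in auto)
    then show ?thesis
      using m monoD[OF assms(1), of a m] by auto
  qed
  then show ?thesis
    by (simp add: adjoint_def)
qed

lemma adjoint_mono_left:
  assumes "adjoint f g"
  shows "mono f"
  using assms unfolding adjoint_def by (metis monoI order_refl order_trans)

lemma adjoint_has_residual:
  assumes "adjoint f g"
  shows "has_residual f"
  using assms unfolding adjoint_def has_residual_def by blast

lemma adjoint_has_dual_residual:
  assumes "adjoint f g"
  shows "has_dual_residual g"
  using assms unfolding adjoint_def has_dual_residual_def by blast

lemma residual_eq:
  assumes "adjoint f g"
  shows "residual f = g"
  unfolding residual_def
  by (rule ext, rule Greatest_equality) (use assms in \<open>auto simp: adjoint_def\<close>)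

lemma dual_residual_eq:
  assumes "adjoint f g"
  shows "dual_residual g = f"
  unfolding dual_residual_def
  by (rule ext, rule Least_equality) (use assms in \<open>auto simp: adjoint_def\<close>)

section \<open>Residuals of all orders on a chain with successor and predecessor\<close>

locale discrete_chain =
  fixes s p :: "'a::linorder \<Rightarrow> 'a"
  assumes less_iff_succ_le: "x < y \<longleftrightarrow> s x \<le> y"
    and less_iff_le_pred: "x < y \<longleftrightarrow> x \<le> p y"
    and succ_pred: "s (p x) = x"
    and pred_succ: "p (s x) = x"
begin

lemma adjoint_right:
  assumes "adjoint f g"
  shows "adjoint g (p \<circ> f \<circ> s)"
  unfolding adjoint_def
proof (intro allI)
  fix b a
  have "g b \<le> a \<longleftrightarrow> \<not> s a \<le> g b"
    by (metis less_iff_succ_le not_less)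
  also have "\<dots> \<longleftrightarrow> b < f (s a)"
    using assms by (metis adjoint_def not_le)
  finally show "g b \<le> a \<longleftrightarrow> b \<le> (p \<circ> f \<circ> s) a"
    by (simp add: less_iff_le_pred)
qed

text \<open>Mirror image of \<open>adjoint_right\<close>: a right adjoint of \<open>f\<close> also
  produces a left adjoint of \<open>f\<close>, hence a dual residual.\<close>

lemma adjoint_left:
  assumes "adjoint f g"
  shows "adjoint (s \<circ> g \<circ> p) f"
  unfolding adjoint_def
proof (intro allI)
  fix a b
  have "(s \<circ> g \<circ> p) a \<le> b \<longleftrightarrow> \<not> b \<le> g (p a)"
    by (simp add: less_iff_succ_le[symmetric] not_le)
  also have "\<dots> \<longleftrightarrow> \<not> f b < a"
    using assms by (simp add: adjoint_def less_iff_le_pred)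
  finally show "(s \<circ> g \<circ> p) a \<le> b \<longleftrightarrow> a \<le> f b"
    by (simp add: not_less)
qed

text \<open>Having a right adjoint is the invariant carried along the iteration of
  residuals.\<close>

lemma residual_adjoint:
  fixes f :: "'a \<Rightarrow> 'a"
  assumes "\<exists>g. adjoint f g"
  shows "\<exists>g. adjoint (residual f) g"
proof -
  obtain g where "adjoint f g"
    using assms by blast
  then show ?thesis
    using adjoint_right[of f g] residual_eq[of f g] by auto
qed

lemma dual_residual_adjoint:
  fixes f :: "'a \<Rightarrow> 'a"
  assumes "\<exists>g. adjoint f g"
  shows "adjoint (dual_residual f) f"
proof -
  obtain g where "adjoint f g"
    using assms by blast
  from adjoint_left[OF this] show ?thesis
    using dual_residual_eq[of _ f] by simp
qed

lemma residual_power_adjoint: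
  fixes f :: "'a \<Rightarrow> 'a"
  assumes "\<exists>g. adjoint f g"
  shows "\<exists>g. adjoint ((residual ^^ k) f) g"
proof (induction k)
  case (Suc k)
  from residual_adjoint[OF this] show ?case
    by simp
qed (use assms in simp)

lemma dual_residual_power_adjoint:
  fixes f :: "'a \<Rightarrow> 'a"
  assumes "\<exists>g. adjoint f g"
  shows "\<exists>g. adjoint ((dual_residual ^^ k) f) g"
proof (induction k)
  case (Suc k)
  from dual_residual_adjoint[OF this] show ?case
    by auto
qed (use assms in simp)

lemma residual_dual_residual:
  fixes f :: "'a \<Rightarrow> 'a"
  assumes "\<exists>g. adjoint f g"
  shows "residual (dual_residual f) = f"
  by (rule residual_eq[OF dual_residual_adjoint[OF assms]])

lemma dual_residual_residual:
  fixes f :: "'a \<Rightarrow> 'a"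
  assumes "\<exists>g. adjoint f g"
  shows "dual_residual (residual f) = f"
  using assms residual_eq dual_residual_eq by fastforce

text \<open>Cancellation takes place in the middle, where the innermost \<open>residual\<close>
  meets the outermost \<open>dual_residual\<close>; the map below that pair has a right adjoint by
  the invariant.\<close>

lemma residual_power_dual_residual_power:
  fixes f :: "'a \<Rightarrow> 'a"
  assumes "\<exists>g. adjoint f g"
  shows "(residual ^^ k) ((dual_residual ^^ k) f) = f"
proof (induction k)
  case (Suc k)
  then show ?case
    using residual_dual_residual[OF dual_residual_power_adjoint[OF assms, of k]]
    by (simp add: funpow_swap1)
qed simp

lemma dual_residual_power_residual_power:
  fixes f :: "'a \<Rightarrow> 'a"
  assumes "\<exists>g. adjoint f g"
  shows "(dual_residual ^^ k) ((residual ^^ k) f) = f"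
proof (induction k)
  case (Suc k)
  then show ?case
    using dual_residual_residual[OF residual_power_adjoint[OF assms, of k]]
    by (simp add: funpow_swap1)
qed simp

text \<open>Each pair of residuals conjugates by \<open>s\<close>. The exponent is split into two
  blocks of \<open>k\<close> because \<open>periodic_maps_iff\<close> applies
  \<open>residual ^^ n\<close> to \<open>(residual ^^ n) f\<close>.\<close>

lemma residual_power_double:
  fixes f :: "'a \<Rightarrow> 'a"
  assumes "\<exists>g. adjoint f g"
  shows "(residual ^^ k) ((residual ^^ k) f) = (p ^^ k) \<circ> f \<circ> (s ^^ k)"
proof (induction k)
  case (Suc k)
  obtain g where "adjoint ((residual ^^ k) ((residual ^^ k) f)) g"
    using residual_power_adjoint[OF residual_power_adjoint[OF assms]] by blast
  \<comment> \<open>With \<open>F\<close> the map of the induction hypothesis, the residual of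
    \<open>F\<close> is \<open>g\<close>, and the residual of \<open>g\<close> is
    \<open>p \<circ> F \<circ> s\<close>.\<close>
  from residual_eq[OF this] residual_eq[OF adjoint_right[OF this]]
  have "residual (residual ((residual ^^ k) ((residual ^^ k) f)))
      = p \<circ> ((p ^^ k) \<circ> f \<circ> (s ^^ k)) \<circ> s"
    by (simp add: Suc comp_def)
  then show ?case
    by (simp add: funpow_swap1 fun_eq_iff)
qed simp

lemma succ_power_pred_power: "(s ^^ k) ((p ^^ k) x) = x"
proof (induction k)
  case (Suc k)
  then show ?case
    using funpow_swap1[of s k "p ((p ^^ k) x)"] by (simp add: succ_pred)
qed simp

lemma pred_power_succ_power: "(p ^^ k) ((s ^^ k) x) = x"
proof (induction k)
  case (Suc k)
  then show ?case
    using funpow_swap1[of p k "s ((s ^^ k) x)"] by (simp add: pred_succ)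
qed simp

lemma residuated_maps_iff:
  fixes f :: "'a \<Rightarrow> 'a"
  shows "f \<in> residuated_maps \<longleftrightarrow> (\<exists>g. adjoint f g)"
proof
  assume "f \<in> residuated_maps"
  then have "mono f" "has_residual ((residual ^^ 0) f)"
    unfolding residuated_maps_def by blast+
  then show "\<exists>g. adjoint f g"
    using adjoint_residual by auto
next
  assume f: "\<exists>g. adjoint f g"
  have "has_residual ((residual ^^ k) f)" for k
    using residual_power_adjoint[OF f] adjoint_has_residual by blast
  \<comment> \<open>Each iterate has a right adjoint, so \<open>adjoint_left\<close> exhibits it as
    the right half of another pair.\<close>
  moreover have "has_dual_residual ((dual_residual ^^ k) f)" for k
    using dual_residual_power_adjoint[OF f] adjoint_left adjoint_has_dual_residual by blast
  ultimately show "f \<in> residuated_maps"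
    using f by (auto simp: residuated_maps_def intro: adjoint_mono_left)
qed

lemma periodic_maps_iff:
  fixes f :: "'a \<Rightarrow> 'a"
  shows "f \<in> periodic_maps n \<longleftrightarrow> (\<exists>g. adjoint f g) \<and> (\<forall>x. f ((s ^^ n) x) = (s ^^ n) (f x))"
proof (cases "\<exists>g. adjoint f g")
  case True
  \<comment> \<open>Apply \<open>residual ^^ n\<close> to both sides in one direction and
    \<open>dual_residual ^^ n\<close> in the other, then cancel.\<close>
  have "(dual_residual ^^ n) f = (residual ^^ n) f \<longleftrightarrow> f = (residual ^^ n) ((residual ^^ n) f)"
    using residual_power_dual_residual_power[OF True, of n]
      dual_residual_power_residual_power[OF residual_power_adjoint[OF True], of n n]
    by metis
  also have "\<dots> \<longleftrightarrow> (\<forall>x. f x = (p ^^ n) (f ((s ^^ n) x)))"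
    by (simp add: residual_power_double[OF True] fun_eq_iff)
  also have "\<dots> \<longleftrightarrow> (\<forall>x. f ((s ^^ n) x) = (s ^^ n) (f x))"
    by (metis pred_power_succ_power succ_power_pred_power)
  finally show ?thesis
    using True by (simp add: periodic_maps_def residuated_maps_iff)
qed (simp add: periodic_maps_def residuated_maps_iff)

end

section \<open>Integer maps commuting with a shift\<close>

lemma add_mult_of_shift_eq:
  fixes h :: "int \<Rightarrow> int"
  assumes "\<And>x. h (x + n) = h x + n"
  shows "h (x + k * n) = h x + k * n"
\<comment> \<open>The induction runs both ways from 0, since the quotient
  \<open>(b - h 0) div n\<close> used as \<open>k\<close> below may be negative.\<close>
proof (induction k rule: int_induct[where k = 0])
  case (step1 i)
  then show ?case
    using assms[of "x + i * n"] by (simp add: algebra_simps)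
next
  case (step2 i)
  then show ?case
    using assms[of "x + (i - 1) * n"] by (simp add: algebra_simps)
qed simp

text \<open>Since \<open>h\<close> gains exactly \<open>n\<close> over each period, the search for
  the largest \<open>a\<close> with \<open>h a \<le> b\<close> can be confined to one period, a
  finite set.\<close>

lemma int_periodic_adjoint:
  fixes h :: "int \<Rightarrow> int"
  assumes "mono h" "n > 0" and shift: "\<And>x. h (x + n) = h x + n"
  shows "\<exists>g. adjoint h g"
proof -
  have "\<exists>m. h m \<le> b \<and> (\<forall>a. h a \<le> b \<longrightarrow> a \<le> m)" for b
  proof -
    \<comment> \<open>\<open>q\<close> is the multiple of \<open>n\<close> with
      \<open>h q \<le> b < h (q + n)\<close>: monotonicity excludes everything from
      \<open>q + n\<close> on, and anything below \<open>q\<close> is beaten by \<open>q\<close>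
      itself.\<close>
    define q where "q = (b - h 0) div n * n"
    have q: "q \<le> b - h 0" "b - h 0 < q + n"
      unfolding q_def using assms(2) div_mult_mod_eq[of "b - h 0" n]
        pos_mod_bound[of n "b - h 0"] pos_mod_sign[of n "b - h 0"] by linarith+
    have hq: "h q = h 0 + q"
      using add_mult_of_shift_eq[of h n 0, OF shift] by (simp add: q_def)
    define A where "A = {a \<in> {q..<q + n}. h a \<le> b}"
    have A: "finite A" "q \<in> A"
      using q(1) hq assms(2) by (auto simp: A_def intro: finite_subset[of _ "{q..<q + n}"])
    have "a \<le> Max A" if "h a \<le> b" for a
    proof (cases "q \<le> a")
      case True
      have "a < q + n"
        using monoD[OF assms(1), of "q + n" a] shift[of q] hq q(2) that by linarith
      then show ?thesis
        using A(1) True that by (intro Max_ge) (auto simp: A_def)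
    next
      case False
      then show ?thesis
        using Max_ge[OF A] by linarith
    qed
    moreover have "Max A \<in> A"
      using Max_in[of A] A by blast
    then have "h (Max A) \<le> b"
      unfolding A_def by blast
    ultimately show ?thesis
      by blast
  qed
  then have "has_residual h"
    by (simp add: has_residual_def)
  then show ?thesis
    using adjoint_residual assms(1) by blast
qed

section \<open>The membership criterion for \<open>\<int>\<close> and for
  \<open>J \<times> \<int>\<close>\<close>

interpretation int_chain: discrete_chain "\<lambda>x::int. x + 1" "\<lambda>x. x - 1"
  by unfold_locales auto

text \<open>Blocks \<open>{j} \<times> \<int>\<close> have neither a first nor a last element, so
  immediate neighbours always lie in the same block.\<close>

interpretation lex_chain: discrete_chain
  "map_prod id (\<lambda>x. x + 1) :: 'j::linorder \<times> int \<Rightarrow> 'j \<times> int" "map_prod id (\<lambda>x. x - 1)"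
  by unfold_locales (auto simp: less_prod_def' less_eq_prod_def split: prod.splits)

lemma funpow_add_one: "((\<lambda>x::int. x + 1) ^^ n) x = x + int n"
  by (induction n) auto

lemma funpow_map_prod_add_one:
  "(map_prod id (\<lambda>x. x + 1) ^^ n) (j, x::int) = (j, x + int n)"
  by (induction n) auto

text \<open>For positive \<open>n\<close> the shift condition together with monotonicity supplies
  the adjoint.\<close>

lemma int_periodic_maps_iff:
  fixes h :: "int \<Rightarrow> int"
  assumes "n \<ge> 1"
  shows "h \<in> periodic_maps n \<longleftrightarrow> mono h \<and> (\<forall>x. h (x + int n) = h x + int n)"
  using int_periodic_adjoint[of h "int n"] assms
  by (auto simp: int_chain.periodic_maps_iff funpow_add_one intro: adjoint_mono_left)

text \<open>Unlike over \<open>\<int>\<close>, monotonicity cannot replace the adjoint here: over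
  the naturals, \<open>(j, r) \<mapsto> (j + 1, r)\<close> is monotone and commutes with all shifts,
  but has no residual at \<open>(0, 0)\<close>.\<close>

lemma lex_periodic_maps_iff:
  fixes f :: "'j::linorder \<times> int \<Rightarrow> 'j \<times> int"
  shows "f \<in> periodic_maps n \<longleftrightarrow>
    (\<exists>g. adjoint f g) \<and> (\<forall>j r. f (j, r + int n) = (fst (f (j, r)), snd (f (j, r)) + int n))"
proof -
  have "(map_prod id (\<lambda>x. x + 1) ^^ n) y = (fst y, snd y + int n)" for y :: "'j \<times> int"
    using funpow_map_prod_add_one[of n "fst y" "snd y"] by simp
  then show ?thesis
    by (simp add: lex_chain.periodic_maps_iff)
qed

section \<open>Splitting and assembling maps on the lexicographic product\<close>

lemma lex_periodic_decompose:
  fixes f :: "'j::linorder \<times> int \<Rightarrow> 'j \<times> int" and n :: nat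
  assumes "n \<ge> 1" "f \<in> periodic_maps n"
  defines "g \<equiv> \<lambda>j. fst (f (j, 0))" and "h \<equiv> \<lambda>j r. snd (f (j, r))"
  shows "f (j, r) = (g j, h j r)" "mono g" "bij g" "h j \<in> periodic_maps n"
proof -
  obtain f' where adj: "adjoint f f'"
    and shift: "\<And>j r. f (j, r + int n) = (fst (f (j, r)), snd (f (j, r)) + int n)"
    using assms(2) by (auto simp: lex_periodic_maps_iff)
  have mono: "f x \<le> f y" if "x \<le> y" for x y
    using monoD[OF adjoint_mono_left[OF adj] that] .
  have fst_mono: "fst x \<le> fst y" if "x \<le> y" for x y :: "'j \<times> int"
    using that by (auto simp: less_eq_prod_def)
  have h_shift: "h j (r + int n) = h j r + int n" for j r
    by (simp add: h_def shift)
  have h_shifts: "h j (k * int n) = h j 0 + k * int n" for j k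
    using add_mult_of_shift_eq[of "h j" "int n" 0 k, OF h_shift] by simp
  have fst_nat: "fst (f (j, r + int k * int n)) = fst (f (j, r))" for j r k
  proof (induction k)
    case (Suc k)
    then show ?case
      using shift[of j "r + int k * int n"] by (simp add: algebra_simps)
  qed simp
  have fst_eq: "fst (f (j, r)) = g j" for j r
  proof (rule antisym)
    \<comment> \<open>As \<open>n \<ge> 1\<close>, \<open>\<bar>r\<bar>\<close> periods lift 0 to at
      least \<open>r\<close>, and lift \<open>r\<close> to at least 0. Upward shifts thus give both
      bounds, and by \<open>fst_nat\<close> they leave the block of the image unchanged.\<close>
    have *: "\<bar>r\<bar> \<le> int (nat \<bar>r\<bar>) * int n"
      using assms(1) mult_left_mono[of 1 "int n" "\<bar>r\<bar>"] by simp
    then have "(j, r) \<le> (j, 0 + int (nat \<bar>r\<bar>) * int n)"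
      by (simp add: less_eq_prod_def)
    from fst_mono[OF mono[OF this]] show "fst (f (j, r)) \<le> g j"
      by (simp only: fst_nat g_def)
    have "(j, 0) \<le> (j, r + int (nat \<bar>r\<bar>) * int n)"
      using * by (simp add: less_eq_prod_def)
    from fst_mono[OF mono[OF this]] show "g j \<le> fst (f (j, r))"
      by (simp only: fst_nat g_def)
  qed
  show f_eq: "f (j, r) = (g j, h j r)" for j r
    using fst_eq by (simp add: h_def prod_eq_iff)
  show "mono g"
  proof (rule monoI)
    fix i j :: 'j
    assume "i \<le> j"
    then show "g i \<le> g j"
      using fst_mono[OF mono[of "(i, 0)" "(j, 0)"]] by (auto simp: g_def less_eq_prod_def)
  qed
  have "mono (h j)"
  proof (rule monoI)
    fix x y :: int
    assume "x \<le> y"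
    then show "h j x \<le> h j y"
      using mono[of "(j, x)" "(j, y)"] by (simp add: f_eq less_eq_prod_def)
  qed
  then show "h j \<in> periodic_maps n"
    using h_shift assms(1) by (simp add: int_periodic_maps_iff)
  have "g i \<noteq> g j" if "i < j" for i j
  proof
    assume "g i = g j"
    \<comment> \<open>All of block \<open>i\<close> lies below \<open>(j, 0)\<close>. If both blocks
      had the same image, the second coordinates of \<open>f (i, k * int n)\<close> would be bounded
      by \<open>h j 0\<close>; this \<open>k\<close> exceeds the gap, and \<open>k \<ge> 0\<close>
      gives \<open>k \<le> k * int n\<close>.\<close>
    define k where "k = \<bar>h j 0 - h i 0\<bar> + 1"
    have "f (i, k * int n) \<le> f (j, 0)"
      using that by (intro mono) (simp add: less_eq_prod_def)
    then have "h i 0 + k * int n \<le> h j 0"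
      using \<open>g i = g j\<close> by (simp add: f_eq less_eq_prod_def h_shifts)
    moreover have "k \<le> k * int n"
      using mult_left_mono[of 1 "int n" k] assms(1) by (simp add: k_def)
    ultimately show False
      using k_def by linarith
  qed
  then have "inj g"
    by (intro linorder_injI) auto
  moreover have "surj g"
  proof (rule surjI)
    fix i
    \<comment> \<open>\<open>(j, r)\<close> is the largest point sent to at most
      \<open>(i, 0)\<close>. One period later the image is above \<open>(i, 0)\<close> but still in
      block \<open>g j\<close>, which squeezes \<open>g j\<close> to \<open>i\<close>.\<close>
    obtain j r where jr: "f' (i, 0) = (j, r)"
      by (cases "f' (i, 0)")
    have "f (j, r) \<le> (i, 0)"
      using adj jr by (simp add: adjoint_def)
    moreover have "\<not> f (j, r + int n) \<le> (i, 0)"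
      using adj jr assms(1) by (simp add: adjoint_def less_eq_prod_def)
    ultimately show "g (fst (f' (i, 0))) = i"
      using jr by (auto simp: f_eq less_eq_prod_def)
  qed
  ultimately show "bij g"
    by (simp add: bij_def)
qed

text \<open>The adjoint is assembled blockwise: \<open>inv g\<close> finds the one block mapped into
  block \<open>i\<close>, and the adjoint of that block's map acts on the second coordinate.\<close>

lemma lex_periodic_compose:
  fixes g :: "'j::linorder \<Rightarrow> 'j" and h :: "'j \<Rightarrow> int \<Rightarrow> int"
  assumes "mono g" "bij g" and h: "\<And>j. h j \<in> periodic_maps n"
    and f: "\<And>j r. f (j, r) = (g j, h j r)"
  shows "f \<in> periodic_maps n"
proof -
  have "\<forall>j. \<exists>k. adjoint (h j) k"
    using h by (simp add: int_chain.periodic_maps_iff)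
  then obtain h' where h': "\<And>j. adjoint (h j) (h' j)"
    by metis
  \<comment> \<open>As an order isomorphism, \<open>g\<close> can be moved across both
    \<open><\<close> and \<open>=\<close>, the two cases of a lexicographic comparison.\<close>
  have less: "g j < i \<longleftrightarrow> j < inv g i" and eq: "g j = i \<longleftrightarrow> j = inv g i" for i j
    using assms(1,2) strict_mono_less[of g j "inv g i"]
    by (auto simp: bij_is_surj surj_f_inv_f bij_is_inj strict_mono_iff_mono)
  have "adjoint f (\<lambda>(i, z). (inv g i, h' (inv g i) z))"
    using h' by (auto simp: adjoint_def f less_eq_prod_def le_less less eq)
  moreover have "h j (r + int n) = h j r + int n" for j r
    using h[of j] by (simp add: int_chain.periodic_maps_iff funpow_add_one)
  ultimately show ?thesis
    by (auto simp: lex_periodic_maps_iff f)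
qed

theorem theorem2p12:
  fixes f :: "'j::linorder \<times> int \<Rightarrow> 'j \<times> int" and n :: nat
  assumes "n \<ge> 1"
  shows "f \<in> periodic_maps n \<longleftrightarrow>
    (\<exists>(ftilde :: 'j \<Rightarrow> 'j) (fbar :: 'j \<Rightarrow> int \<Rightarrow> int).
       mono ftilde \<and> bij ftilde \<and>
       (\<forall>j. fbar j \<in> periodic_maps n) \<and>
       (\<forall>j r. f (j, r) = (ftilde j, fbar j r)))"
proof
  assume "f \<in> periodic_maps n"
  from lex_periodic_decompose[OF assms this]
  show "\<exists>ftilde fbar. mono ftilde \<and> bij ftilde \<and> (\<forall>j. fbar j \<in> periodic_maps n) \<and>
      (\<forall>j r. f (j, r) = (ftilde j, fbar j r))"
    by (intro exI conjI allI)
next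
  assume "\<exists>ftilde fbar. mono ftilde \<and> bij ftilde \<and> (\<forall>j. fbar j \<in> periodic_maps n) \<and>
      (\<forall>j r. f (j, r) = (ftilde j, fbar j r))"
  then show "f \<in> periodic_maps n"
    using lex_periodic_compose by blast
qed

end
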